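(* Let $\Sigma$ be a set of constraints (TGDs and EGDs), $I_0$ a database instance, and $k\in\mathbb{N}$ (where $\mathbb{N}$ does not include $0$). If there is some infinite chase sequence $\mathcal{S}$ when chasing $I_0$ with $\Sigma$, then there is some finite prefix of $\mathcal{S}$ that is $k$-cyclic.
   Context: **Databases.** Fix pairwise disjoint infinite sets $\Delta$ (constants), $\Delta_{null}$ (labeled nulls), $V$ (variables), and a finite relational schema $\mathcal{R}$. A database instance $I$ is a finite set of $\mathcal{R}$-atoms (facts) with entries in $\Delta\cup\Delta_{null}$. A position is an argument place $R^i$ of a relation symbol $R$. **Constraints.** All constraint sets are finite. A TGD is a sentence $\forall\overline{x}(\phi(\overline{x})\to\exists\overline{y}\,\psi(\overline{x},\overline{y}))$ with $\phi$ (body, possibly empty) and $\psi$ (head, nonempty) conjunctions of equality-free atoms, possibly with constants from $\Delta$, where every variable of $\overline{x}$ occurring in $\psi$ occurs in $\phi$. An EGD is a sentence $\forall\overline{x}(\phi(\overline{x})\to x_i=x_j)$ with $\phi$ a nonempty conjunction of equality-free atoms (possibly with constants) and $x_i,x_j$ occurring in $\phi$. **Chase.** For a constraint $\alpha$ and a tuple $\overline{a}$ of values for its universally quantified variables, $\alpha(\overline{a})$ denotes the instantiated constraint. A chase step $I\stackrel{\alpha,\overline{a}}{\to}J$ is possible when $I\nvDash\alpha(\overline{a})$. For a TGD, $J$ is obtained by adding the facts of the head instantiated with $\overline{a}$ and with fresh distinct labeled nulls for $\overline{y}$. For an EGD, $J$ is obtained by identifying the two values in question (a labeled null is replaced everywhere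 by the other value; if both are constants the step cannot be performed). A chase sequence of $I_0$ with $\Sigma$ is an exhaustive application of chase steps $I_0\stackrel{\varphi_0,\overline{a}_0}{\to}I_1\stackrel{\varphi_1,\overline{a}_1}{\to}\cdots$ with $\varphi_i\in\Sigma$, in arbitrary order. **Monitor graph.** A monitor graph is a pair $(V,E)$ whose nodes are pairs $(n,\pi)$ with $n$ a labeled null and $\pi$ a set of positions, and whose edges are tuples $(n_1,\pi_1,\varphi,\Pi,n_2,\pi_2)$ from node $(n_1,\pi_1)$ to node $(n_2,\pi_2)$, with $\varphi\in\Sigma$ and $\Pi$ a set of positions. The monitor graph $G_{\mathcal{S}}=G_r$ of a finite sequence of chase steps $\mathcal{S}=I_0\stackrel{\varphi_0,\overline{a}_0}{\to}\cdots\stackrel{\varphi_{r-1},\overline{a}_{r-1}}{\to}I_r$ is defined inductively. $G_0=(\emptyset,\emptyset)$. For $i<r$: if $\varphi_i$ is an EGD, or if it is a TGD and the $i$-th step introduces no new null values, then $G_{i+1}:=G_i$. Otherwise, with $G_i=(V_i,E_i)$, $V_{i+1}$ is the union of $V_i$ and all pairs $(n,\pi)$ where $n$ is a newly introduced null value and $\pi$ is the set of positions in which $n$ occurs, and $E_{i+1}:=E_i\cup\{(n_1,\pi_1,\varphi_i,\Pi,n_2,\pi_2) \mid (n_1,\pi_1)\in V_i,\ (n_2,\pi_2)\in V_{i+1}\setminus V_i,\ \Pi$ is the set of positions in $body(\varphi_i(\overline{a}_i))$ where $n_1$ occurs$\}$. **$k$-cyclicity.** For an edge $e=(n_1,\pi_1,\varphi,\Pi,n_2,\pi_2)$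 write $p_{2,3,4,6}(e)=(\pi_1,\varphi,\Pi,\pi_2)$. A path is a finite sequence of edges in which the end node $(n_2,\pi_2)$ of each edge is the start node of the next. A monitor graph $(V,E)$ is $k$-cyclic iff there are pairwise distinct edges $v_1,\dots,v_k\in E$ such that there is a path that sequentially contains $v_1$ to $v_k$, and $p_{2,3,4,6}(v_i)=p_{2,3,4,6}(v_{i+1})$ for all $i\in\{1,\dots,k-1\}$. A finite sequence of chase steps (in particular a finite prefix of a chase sequence) is $k$-cyclic iff its monitor graph is. *)

theory Defs
  imports Main "HOL-Library.Sublist" "HOL-Library.Infinite_Typeclass"
begin

(* The pairwise disjoint infinite sets of constants, labeled nulls and variables are the type
   parameters 'c, 'n and 'v.  Terms occur in constraints, values in database instances. *)

datatype ('c, 'v) trm = Cst 'c | Var 'v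

datatype ('c, 'n) val = Const 'c | Null 'n

datatype ('r, 'e) atom = Atom (rel: 'r) (args: "'e list")

type_synonym ('r, 'c, 'n) db = "('r, ('c, 'n) val) atom set"

(* A relational schema is a set Rs of relation symbols with an arity function ar. *)

definition over_schema :: "'r set \<Rightarrow> ('r \<Rightarrow> nat) \<Rightarrow> ('r, 'e) atom \<Rightarrow> bool" where
  "over_schema Rs ar A \<longleftrightarrow> rel A \<in> Rs \<and> length (args A) = ar (rel A)"

definition db_instance :: "'r set \<Rightarrow> ('r \<Rightarrow> nat) \<Rightarrow> ('r, 'c, 'n) db \<Rightarrow> bool" where
  "db_instance Rs ar I \<longleftrightarrow> finite I \<and> (\<forall>A\<in>I. over_schema Rs ar A)"

(* The pair (R, i) is the argument place number i of R, counted from 0. *)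

type_synonym 'r position = "'r \<times> nat"

definition null_positions :: "'n \<Rightarrow> ('r, 'c, 'n) db \<Rightarrow> 'r position set" where
  "null_positions n F =
     {(rel A, i) | A i. A \<in> F \<and> i < length (args A) \<and> args A ! i = Null n}"

definition nulls :: "('r, 'c, 'n) db \<Rightarrow> 'n set" where
  "nulls F = {n. \<exists>A\<in>F. Null n \<in> set (args A)}"

(* TGD xs B ys H is the sentence  ALL xs. (B --> EX ys. H),  and  EGD xs B x y  is the sentence
   ALL xs. (B --> x = y);  B and H are conjunctions of atoms, given as lists. *)

datatype ('r, 'c, 'v) constr =
    TGD "'v list" "('r, ('c, 'v) trm) atom list" "'v list" "('r, ('c, 'v) trm) atom list"
  | EGD "'v list" "('r, ('c, 'v) trm) atom list" 'v 'v

fun body :: "('r, 'c, 'v) constr \<Rightarrow> ('r, ('c, 'v) trm) atom list" where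
  "body (TGD xs B ys H) = B"
| "body (EGD xs B x y) = B"

fun is_TGD :: "('r, 'c, 'v) constr \<Rightarrow> bool" where
  "is_TGD (TGD xs B ys H) = True"
| "is_TGD (EGD xs B x y) = False"

definition conj_vars :: "('r, ('c, 'v) trm) atom list \<Rightarrow> 'v set" where
  "conj_vars B = {x. \<exists>A\<in>set B. Var x \<in> set (args A)}"

fun wf_constr :: "'r set \<Rightarrow> ('r \<Rightarrow> nat) \<Rightarrow> ('r, 'c, 'v) constr \<Rightarrow> bool" where
  "wf_constr Rs ar (TGD xs B ys H) \<longleftrightarrow>
     distinct xs \<and> distinct ys \<and> set xs \<inter> set ys = {} \<and> H \<noteq> [] \<and>
     (\<forall>A \<in> set B \<union> set H. over_schema Rs ar A) \<and>
     conj_vars B \<subseteq> set xs \<and> conj_vars H \<subseteq> set xs \<union> set ys \<and>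
     set xs \<inter> conj_vars H \<subseteq> conj_vars B"
| "wf_constr Rs ar (EGD xs B x y) \<longleftrightarrow>
     distinct xs \<and> B \<noteq> [] \<and> (\<forall>A \<in> set B. over_schema Rs ar A) \<and>
     conj_vars B \<subseteq> set xs \<and> x \<in> conj_vars B \<and> y \<in> conj_vars B"

fun trm_val :: "('v \<Rightarrow> ('c, 'n) val) \<Rightarrow> ('c, 'v) trm \<Rightarrow> ('c, 'n) val" where
  "trm_val a (Cst c) = Const c"
| "trm_val a (Var x) = a x"

definition inst_conj ::
    "('v \<Rightarrow> ('c, 'n) val) \<Rightarrow> ('r, ('c, 'v) trm) atom list \<Rightarrow> ('r, 'c, 'n) db" where
  "inst_conj a B = (\<lambda>A. Atom (rel A) (map (trm_val a) (args A))) ` set B"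

(* A tuple of values for the universally quantified variables xs is an assignment a, whose values
   outside xs play no role: override_on a b (set ys) gives the ys the values b, all other
   variables the values a. *)

fun sat :: "('r, 'c, 'n) db \<Rightarrow> ('r, 'c, 'v) constr \<Rightarrow> ('v \<Rightarrow> ('c, 'n) val) \<Rightarrow> bool" where
  "sat I (TGD xs B ys H) a \<longleftrightarrow>
     (inst_conj a B \<subseteq> I \<longrightarrow> (\<exists>b. inst_conj (override_on a b (set ys)) H \<subseteq> I))"
| "sat I (EGD xs B x y) a \<longleftrightarrow> (inst_conj a B \<subseteq> I \<longrightarrow> a x = a y)"

definition replace_null :: "'n \<Rightarrow> ('c, 'n) val \<Rightarrow> ('r, 'c, 'n) db \<Rightarrow> ('r, 'c, 'n) db" where
  "replace_null n w I =
     (\<lambda>A. Atom (rel A) (map (\<lambda>u. if u = Null n then w else u) (args A))) ` I"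

(* The effect of applying a constraint, where the nulls in U count as used, i.e. not fresh.  If an
   EGD equates two nulls, either one may be replaced by the other; if it equates two
   distinct constants, there is no result. *)

fun chase_result ::
    "'n set \<Rightarrow> ('r, 'c, 'n) db \<Rightarrow> ('r, 'c, 'v) constr \<Rightarrow> ('v \<Rightarrow> ('c, 'n) val) \<Rightarrow> ('r, 'c, 'n) db \<Rightarrow> bool"
  where
  "chase_result U I (TGD xs B ys H) a J \<longleftrightarrow>
     (\<exists>f. inj_on f (set ys) \<and> f ` set ys \<inter> U = {} \<and>
          J = I \<union> inst_conj (override_on a (\<lambda>y. Null (f y)) (set ys)) H)"
| "chase_result U I (EGD xs B x y) a J \<longleftrightarrow>
     (\<exists>n w. {a x, a y} = {Null n, w} \<and> J = replace_null n w I)"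

definition chase_step ::
    "'n set \<Rightarrow> ('r, 'c, 'n) db \<Rightarrow> ('r, 'c, 'v) constr \<Rightarrow> ('v \<Rightarrow> ('c, 'n) val) \<Rightarrow> ('r, 'c, 'n) db \<Rightarrow> bool"
  where
  "chase_step U I \<phi> a J \<longleftrightarrow> \<not> sat I \<phi> a \<and> chase_result U I \<phi> a J"

(* The sequence  D 0 --> D 1 --> D 2 --> ...  of instances, whose step number i applies the
   constraint C i with the tuple a i.  Fresh nulls are new to the whole sequence so far: a null that
   was eliminated by an EGD is not used again.  An infinite sequence is exhaustive because it never
   stops; no fairness is required. *)

definition infinite_chase ::
    "('r, 'c, 'v) constr set \<Rightarrow> ('r, 'c, 'n) db \<Rightarrow> (nat \<Rightarrow> ('r, 'c, 'n) db) \<Rightarrow>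
     (nat \<Rightarrow> ('r, 'c, 'v) constr) \<Rightarrow> (nat \<Rightarrow> 'v \<Rightarrow> ('c, 'n) val) \<Rightarrow> bool" where
  "infinite_chase \<Sigma> I0 D C a \<longleftrightarrow>
     D 0 = I0 \<and>
     (\<forall>i. C i \<in> \<Sigma> \<and> chase_step (\<Union>j\<le>i. nulls (D j)) (D i) (C i) (a i) (D (Suc i)))"

type_synonym ('r, 'n) mnode = "'n \<times> 'r position set"

type_synonym ('r, 'c, 'v, 'n) medge =
  "'n \<times> 'r position set \<times> ('r, 'c, 'v) constr \<times> 'r position set \<times> 'n \<times> 'r position set"

type_synonym ('r, 'c, 'v, 'n) mgraph = "('r, 'n) mnode set \<times> ('r, 'c, 'v, 'n) medge set"

fun monitor_step ::
    "('r, 'c, 'n) db \<Rightarrow> ('r, 'c, 'v) constr \<Rightarrow> ('v \<Rightarrow> ('c, 'n) val) \<Rightarrow> ('r, 'c, 'n) db \<Rightarrow>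
     ('r, 'c, 'v, 'n) mgraph \<Rightarrow> ('r, 'c, 'v, 'n) mgraph" where
  "monitor_step I \<phi> a J (V, E) =
     (if \<not> is_TGD \<phi> \<or> nulls J - nulls I = {} then (V, E)
      else
        let V' = V \<union> {(n, null_positions n J) | n. n \<in> nulls J - nulls I}
        in (V', E \<union> {(n1, \<pi>1, \<phi>, \<Pi>, n2, \<pi>2) | n1 \<pi>1 \<Pi> n2 \<pi>2.
              (n1, \<pi>1) \<in> V \<and> (n2, \<pi>2) \<in> V' - V \<and>
              \<Pi> = null_positions n1 (inst_conj a (body \<phi>))}))"

(* The monitor graph of the first r steps; it does not depend on the later ones. *)

primrec monitor_graph ::
    "(nat \<Rightarrow> ('r, 'c, 'n) db) \<Rightarrow> (nat \<Rightarrow> ('r, 'c, 'v) constr) \<Rightarrow> (nat \<Rightarrow> 'v \<Rightarrow> ('c, 'n) val) \<Rightarrow>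
     nat \<Rightarrow> ('r, 'c, 'v, 'n) mgraph" where
  "monitor_graph D C a 0 = ({}, {})"
| "monitor_graph D C a (Suc r) =
     monitor_step (D r) (C r) (a r) (D (Suc r)) (monitor_graph D C a r)"

fun edge_source :: "('r, 'c, 'v, 'n) medge \<Rightarrow> ('r, 'n) mnode" where
  "edge_source (n1, \<pi>1, \<phi>, \<Pi>, n2, \<pi>2) = (n1, \<pi>1)"

fun edge_target :: "('r, 'c, 'v, 'n) medge \<Rightarrow> ('r, 'n) mnode" where
  "edge_target (n1, \<pi>1, \<phi>, \<Pi>, n2, \<pi>2) = (n2, \<pi>2)"

fun p2346 ::
    "('r, 'c, 'v, 'n) medge \<Rightarrow>
     'r position set \<times> ('r, 'c, 'v) constr \<times> 'r position set \<times> 'r position set" where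
  "p2346 (n1, \<pi>1, \<phi>, \<Pi>, n2, \<pi>2) = (\<pi>1, \<phi>, \<Pi>, \<pi>2)"

definition is_path :: "('r, 'c, 'v, 'n) mgraph \<Rightarrow> ('r, 'c, 'v, 'n) medge list \<Rightarrow> bool" where
  "is_path G p \<longleftrightarrow>
     set p \<subseteq> snd G \<and> (\<forall>i. Suc i < length p \<longrightarrow> edge_target (p ! i) = edge_source (p ! Suc i))"

(* The edges vs occur in the path p in this order, possibly with other edges in between. *)

definition k_cyclic :: "nat \<Rightarrow> ('r, 'c, 'v, 'n) mgraph \<Rightarrow> bool" where
  "k_cyclic k G \<longleftrightarrow>
     (\<exists>vs. length vs = k \<and> distinct vs \<and> set vs \<subseteq> snd G \<and>
        (\<exists>p. is_path G p \<and> subseq vs p) \<and>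
        (\<forall>i. Suc i < k \<longrightarrow> p2346 (vs ! i) = p2346 (vs ! Suc i)))"

end

theory Submission
  imports Defs "HOL-Library.Infinite_Set"
begin

text \<open>
  Infinitely many steps create a null: after the last such step the nulls could only decrease, so
  from some point on every step would be a TGD step that adds a fact over one fixed finite set of
  values.  Pick one null from each creating step.  Since an edge may carry the empty
  set of positions, consecutive picks are always joined by an edge, so these edges form an
  infinite path.  There are finitely many values of \<open>p2346\<close>, so one of them occurs infinitely often
  along this path.
\<close>

section \<open>Values, facts and positions, and their finiteness\<close>

definition vals :: "('r, 'e) atom set \<Rightarrow> 'e set" where
  "vals F = (\<Union>A\<in>F. set (args A))"

lemma vals_Un: "vals (F \<union> G) = vals F \<union> vals G"
  by (auto simp: vals_def)

lemma vals_mono: "F \<subseteq> G \<Longrightarrow> vals F \<subseteq> vals G"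
  by (auto simp: vals_def)

lemma nulls_iff_vals: "n \<in> nulls F \<longleftrightarrow> Null n \<in> vals F"
  by (auto simp: nulls_def vals_def)

lemma finite_vals: "finite F \<Longrightarrow> finite (vals F)"
  by (auto simp: vals_def)

lemma finite_nulls:
  assumes "finite F"
  shows "finite (nulls F)"
proof -
  have "nulls F = Null -` vals F"
    by (auto simp: nulls_iff_vals)
  then show ?thesis
    using finite_vals[OF assms] by (auto intro!: finite_vimageI injI)
qed

lemma vals_inst_conj: "vals (inst_conj a B) = (\<Union>A\<in>set B. trm_val a ` set (args A))"
  by (auto simp: vals_def inst_conj_def)

lemma vals_replace_null:
  "vals (replace_null n w I) = (\<lambda>u. if u = Null n then w else u) ` vals I"
  by (auto simp: vals_def replace_null_def)

lemma over_schema_inst_conj: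
  assumes "\<forall>A\<in>set B. over_schema Rs ar A" and "A \<in> inst_conj a B"
  shows "over_schema Rs ar A"
  using assms by (auto simp: over_schema_def inst_conj_def)

lemma finite_inst_conj: "finite (inst_conj a B)"
  by (simp add: inst_conj_def)

definition positions :: "'r set \<Rightarrow> ('r \<Rightarrow> nat) \<Rightarrow> 'r position set" where
  "positions Rs ar = (SIGMA R:Rs. {..<ar R})"

lemma finite_positions: "finite Rs \<Longrightarrow> finite (positions Rs ar)"
  by (simp add: positions_def)

lemma null_positions_subset:
  assumes "\<forall>A\<in>F. over_schema Rs ar A"
  shows "null_positions n F \<subseteq> positions Rs ar"
  using assms by (auto simp: null_positions_def positions_def over_schema_def)

lemma finite_facts:
  assumes "finite Rs" and "finite W"
  shows "finite {A. over_schema Rs ar A \<and> set (args A) \<subseteq> W}"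
proof (rule finite_subset)
  show "{A. over_schema Rs ar A \<and> set (args A) \<subseteq> W}
      \<subseteq> (\<Union>R\<in>Rs. Atom R ` {xs. set xs \<subseteq> W \<and> length xs = ar R})"
    by (auto simp: over_schema_def) (metis (mono_tags, lifting) atom.collapse imageI mem_Collect_eq)
  show "finite (\<Union>R\<in>Rs. Atom R ` {xs. set xs \<subseteq> W \<and> length xs = ar R})"
    using assms by (simp add: finite_lists_length_eq)
qed

section \<open>Effect of one chase step on values and nulls\<close>

fun head_consts :: "('r, 'c, 'v) constr \<Rightarrow> 'c set" where
  "head_consts (TGD xs B ys H) = {c. Cst c \<in> vals (set H)}"
| "head_consts (EGD xs B x y) = {}"

lemma finite_head_consts: "finite (head_consts \<phi>)"
proof (cases \<phi>)
  case (TGD xs B ys H)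
  have "finite (Cst -` vals (set H))"
    by (intro finite_vimageI finite_vals injI) auto
  then show ?thesis
    by (simp add: TGD vimage_def)
qed auto

lemma wf_constr_body:
  "wf_constr Rs ar \<phi> \<Longrightarrow> \<forall>A\<in>set (body \<phi>). over_schema Rs ar A"
  by (cases \<phi>) auto

lemma conj_var_vals:
  assumes "inst_conj a B \<subseteq> I" and "x \<in> conj_vars B"
  shows "a x \<in> vals I"
proof -
  have "a x \<in> vals (inst_conj a B)"
    using assms(2) by (force simp: vals_inst_conj conj_vars_def)
  then show ?thesis
    using vals_mono[OF assms(1)] by blast
qed

lemma chase_step_instance:
  assumes "chase_step U I \<phi> a J" and "wf_constr Rs ar \<phi>" and "db_instance Rs ar I"
  shows "db_instance Rs ar J"
proof (cases \<phi>)
  case (TGD xs B ys H)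
  then show ?thesis
    using assms over_schema_inst_conj[of H Rs ar]
    by (auto simp: chase_step_def db_instance_def finite_inst_conj)
next
  case (EGD xs B x y)
  then show ?thesis
    using assms by (auto simp: chase_step_def db_instance_def replace_null_def over_schema_def)
qed

text \<open>Since the body is matched, both equated values already occur in \<open>I\<close>. The
  null \<open>n\<close> that is replaced therefore does get lost, and its substitute
  \<open>w\<close>, different from it, is no new value.\<close>

lemma EGD_step_nulls:
  assumes "chase_step U I (EGD xs B x y) a J" and "wf_constr Rs ar (EGD xs B x y)"
  shows "vals J \<subseteq> vals I" and "nulls J \<subset> nulls I"
proof -
  from assms obtain n w where nw: "{a x, a y} = {Null n, w}" and J: "J = replace_null n w I"
    and ne: "a x \<noteq> a y" and B: "inst_conj a B \<subseteq> I"
    by (auto simp: chase_step_def)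
  have "a x \<in> vals I" "a y \<in> vals I"
    using assms(2) conj_var_vals[OF B] by auto
  then have in_I: "Null n \<in> vals I" "w \<in> vals I" and "w \<noteq> Null n"
    using nw ne by (auto simp: doubleton_eq_iff)
  then have "vals J \<subseteq> vals I - {Null n}"
    unfolding J vals_replace_null by auto
  then have "vals J \<subseteq> vals I" and "n \<in> nulls I - nulls J" and "nulls J \<subseteq> nulls I"
    using in_I by (auto simp: nulls_iff_vals)
  then show "vals J \<subseteq> vals I" "nulls J \<subset> nulls I"
    by auto
qed

text \<open>If the step added no fact, the nulls chosen for \<open>ys\<close> would witness the
  existential quantifier, contrary to the violation of the constraint.\<close>

lemma TGD_step_grows:
  assumes "chase_step U I (TGD xs B ys H) a J"
  shows "I \<subset> J"
  using assms by (auto simp: chase_step_def)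

text \<open>Three kinds of terms occur in a head: constants, existential variables, which receive
  nulls outside \<open>U\<close>, and universal variables. By well-formedness the last occur in the
  matched body, so their values come from \<open>I\<close>.\<close>

lemma TGD_step_vals:
  assumes "chase_step U I (TGD xs B ys H) a J" and "wf_constr Rs ar (TGD xs B ys H)"
    and "v \<in> vals J"
  shows "v \<in> vals I \<or> v \<in> Const ` head_consts (TGD xs B ys H) \<or> (\<exists>n. v = Null n \<and> n \<notin> U)"
proof -
  from assms(1) obtain f where f: "f ` set ys \<inter> U = {}" and B: "inst_conj a B \<subseteq> I"
    and J: "J = I \<union> inst_conj (override_on a (\<lambda>y. Null (f y)) (set ys)) H"
    by (auto simp: chase_step_def)
  let ?a = "override_on a (\<lambda>y. Null (f y)) (set ys)"
  show ?thesis
  proof (cases "v \<in> vals I")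
    case False
    then obtain A t where A: "A \<in> set H" "t \<in> set (args A)" and v: "v = trm_val ?a t"
      using assms(3) by (auto simp: J vals_Un vals_inst_conj)
    show ?thesis
    proof (cases t)
      case (Cst c)
      then show ?thesis
        using A v by (auto simp: vals_def)
    next
      case (Var x)
      show ?thesis
      proof (cases "x \<in> set ys")
        case True
        then show ?thesis
          using v Var f by auto
      next
        case x: False
        have "x \<in> conj_vars H"
          using A Var by (auto simp: conj_vars_def)
        then have "x \<in> conj_vars B"
          using assms(2) x by auto
        then show ?thesis
          using conj_var_vals[OF B] v Var x by auto
      qed
    qed
  qed simp
qed

text \<open>Later \<open>U\<close> collects the nulls of all instances so far. A null that is new
  compared with \<open>I\<close> alone is then new to the whole history.\<close>

lemma chase_step_new_null:
  assumes "chase_step U I \<phi> a J" and "wf_constr Rs ar \<phi>" and "n \<in> nulls J - nulls I"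
  shows "is_TGD \<phi>" and "n \<notin> U"
proof -
  have "is_TGD \<phi> \<and> n \<notin> U"
  proof (cases \<phi>)
    case (TGD xs B ys H)
    then show ?thesis
      using TGD_step_vals[of U I xs B ys H a J Rs ar "Null n"] assms
      by (auto simp: nulls_iff_vals)
  next
    case (EGD xs B x y)
    then show ?thesis
      using EGD_step_nulls(2)[of U I xs B x y a J Rs ar] assms by auto
  qed
  then show "is_TGD \<phi>" and "n \<notin> U"
    by auto
qed

lemma chase_step_vals:
  assumes "chase_step U I \<phi> a J" and "wf_constr Rs ar \<phi>" and "nulls J \<subseteq> nulls I"
  shows "vals J \<subseteq> vals I \<union> Const ` head_consts \<phi>"
proof (cases \<phi>)
  case (TGD xs B ys H)
  then show ?thesis
    using TGD_step_vals[of U I xs B ys H a J Rs ar] assms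
    by (auto simp: nulls_iff_vals subset_iff)
next
  case (EGD xs B x y)
  then show ?thesis
    using EGD_step_nulls(1)[of U I xs B x y a J Rs ar] assms by auto
qed

text \<open>Otherwise a lexicographic measure would descend forever from some index \<open>N\<close>
  on. This supplies the nulls through which the infinite path runs.\<close>

lemma infinitely_many_creating_steps:
  fixes I0 :: "('r, 'c, 'n) db"
  assumes "finite Rs" and "finite \<Sigma>" and wf: "\<forall>\<phi>\<in>\<Sigma>. wf_constr Rs ar \<phi>"
    and inst: "\<And>i. db_instance Rs ar (D i)"
    and chase: "infinite_chase \<Sigma> I0 D C a"
  shows "infinite {i. \<not> nulls (D (Suc i)) \<subseteq> nulls (D i)}"
proof
  assume "finite {i. \<not> nulls (D (Suc i)) \<subseteq> nulls (D i)}"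
  then obtain N where N: "\<And>i. i \<ge> N \<Longrightarrow> nulls (D (Suc i)) \<subseteq> nulls (D i)"
    using finite_nat_set_iff_bounded by (metis (mono_tags, lifting) leD mem_Collect_eq)
  have C: "C i \<in> \<Sigma>" and steps: "chase_step (\<Union>j\<le>i. nulls (D j)) (D i) (C i) (a i) (D (Suc i))" for i
    using chase by (auto simp: infinite_chase_def)
  \<comment> \<open>Without new nulls, the only values that can enter after \<open>D N\<close> are
    head constants of the finite set \<Sigma>. So \<open>T\<close> is a finite set that bounds all
    instances from \<open>N\<close> on.\<close>
  define W where "W = vals (D N) \<union> (\<Union>\<phi>\<in>\<Sigma>. Const ` head_consts \<phi>)"
  define T where "T = {A :: ('r, ('c, 'n) val) atom. over_schema Rs ar A \<and> set (args A) \<subseteq> W}"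
  have "finite T"
    unfolding T_def W_def using assms(1,2) inst[of N]
    by (intro finite_facts) (auto intro: finite_vals finite_head_consts simp: db_instance_def)
  have vals_W: "vals (D i) \<subseteq> W" if "i \<ge> N" for i
    using that
  proof (induction i rule: dec_induct)
    case (step i)
    have "vals (D (Suc i)) \<subseteq> vals (D i) \<union> Const ` head_consts (C i)"
      using chase_step_vals[OF steps _ N] C wf step.hyps(1) by blast
    then show ?case
      using step.IH C[of i] by (auto simp: W_def)
  qed (simp add: W_def)
  have D_T: "D i \<subseteq> T" if "i \<ge> N" for i
    using vals_W[OF that] inst[of i] by (auto simp: T_def db_instance_def vals_def)
  \<comment> \<open>An EGD step lowers the number of nulls. A TGD step does not raise it after
    \<open>N\<close>, and lowers the number of facts of \<open>T\<close> still missing, because its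
    additions stay inside \<open>T\<close>.\<close>
  define \<mu> where "\<mu> i = (card (nulls (D i)), card (T - D i))" for i
  have "(\<mu> (Suc i), \<mu> i) \<in> less_than <*lex*> less_than" if i: "i \<ge> N" for i
  proof (cases "C i")
    case (TGD xs B ys H)
    then have "D i \<subset> D (Suc i)"
      using steps[of i] by (auto dest: TGD_step_grows)
    then have "T - D (Suc i) \<subset> T - D i"
      using D_T[of "Suc i"] i by auto
    then have "card (T - D (Suc i)) < card (T - D i)"
      using \<open>finite T\<close> by (intro psubset_card_mono) auto
    moreover have "card (nulls (D (Suc i))) \<le> card (nulls (D i))"
      using N[OF i] inst[of i] by (intro card_mono finite_nulls) (auto simp: db_instance_def)
    ultimately show ?thesis
      by (auto simp: \<mu>_def)
  next
    case (EGD xs B x y)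
    then have "nulls (D (Suc i)) \<subset> nulls (D i)"
      using steps[of i] EGD_step_nulls(2) wf C[of i] by metis
    then have "card (nulls (D (Suc i))) < card (nulls (D i))"
      using inst[of i] by (intro psubset_card_mono finite_nulls) (auto simp: db_instance_def)
    then show ?thesis
      by (simp add: \<mu>_def)
  qed
  then have "\<forall>i. (\<mu> (N + Suc i), \<mu> (N + i)) \<in> less_than <*lex*> less_than"
    by simp
  moreover have "wf (less_than <*lex*> less_than)"
    by (intro wf_lex_prod wf_less_than)
  ultimately show False
    unfolding wf_iff_no_infinite_down_chain by (auto dest!: spec[of _ "\<lambda>i. \<mu> (N + i)"])
qed

section \<open>Growth of the monitor graph, and cyclicity from repeated labels\<close>

lemma monitor_step_mono:
  "fst G \<subseteq> fst (monitor_step I \<phi> a J G)" "snd G \<subseteq> snd (monitor_step I \<phi> a J G)"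
  by (cases G; auto simp: Let_def)+

lemma monitor_graph_mono:
  assumes "r \<le> s"
  shows "fst (monitor_graph D C a r) \<subseteq> fst (monitor_graph D C a s)"
    and "snd (monitor_graph D C a r) \<subseteq> snd (monitor_graph D C a s)"
proof -
  have "fst (monitor_graph D C a r) \<subseteq> fst (monitor_graph D C a s) \<and>
    snd (monitor_graph D C a r) \<subseteq> snd (monitor_graph D C a s)"
    using assms
  proof (induction s rule: dec_induct)
    case (step s)
    then show ?case
      unfolding monitor_graph.simps by (meson monitor_step_mono order_trans)
  qed simp
  then show "fst (monitor_graph D C a r) \<subseteq> fst (monitor_graph D C a s)"
    and "snd (monitor_graph D C a r) \<subseteq> snd (monitor_graph D C a s)"
    by auto
qed

text \<open>This turns freshness of a null into absence from the graph, as edges lead only to nodes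
  that the step adds.\<close>

lemma monitor_graph_nodes:
  "(n, \<pi>) \<in> fst (monitor_graph D C a r) \<Longrightarrow> n \<in> (\<Union>j\<le>r. nulls (D j))"
proof (induction r)
  case (Suc r)
  obtain V E where G: "monitor_graph D C a r = (V, E)"
    by fastforce
  show ?case
    using Suc by (auto simp: G Let_def atMost_Suc split: if_splits)
qed simp

lemma monitor_graph_new_node:
  assumes "is_TGD (C r)" and "n \<in> nulls (D (Suc r)) - nulls (D r)"
  shows "(n, null_positions n (D (Suc r))) \<in> fst (monitor_graph D C a (Suc r))"
  using assms by (cases "monitor_graph D C a r") (auto simp: Let_def)

text \<open>The set \<Pi> is computed from the source null and may be empty, so every old node is a
  source. Only the novelty of the target needs an argument.\<close>

lemma monitor_graph_new_edge:
  assumes "is_TGD (C r)" and "n2 \<in> nulls (D (Suc r))" and "n2 \<notin> (\<Union>j\<le>r. nulls (D j))"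
    and "(n1, \<pi>1) \<in> fst (monitor_graph D C a r)"
  shows "(n1, \<pi>1, C r, null_positions n1 (inst_conj (a r) (body (C r))),
            n2, null_positions n2 (D (Suc r))) \<in> snd (monitor_graph D C a (Suc r))"
proof -
  obtain V E where G: "monitor_graph D C a r = (V, E)"
    by fastforce
  \<comment> \<open>Freshness rules out \<open>n2\<close> with any position set, so its new node
    lies outside \<open>V\<close>.\<close>
  have "(n2, \<pi>) \<notin> V" for \<pi>
    using monitor_graph_nodes[of n2 \<pi> D C a r] assms(3) by (auto simp: G)
  then show ?thesis
    using assms by (auto simp: G Let_def)
qed

text \<open>By the pigeonhole principle one label recurs infinitely often along the infinite path.
  Any \<open>k\<close> of its occurrences lie in a finite initial segment, which some finite stage
  of the graph contains.\<close>

lemma k_cyclic_if_finitely_many_labels: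
  assumes path: "\<And>i. edge_target (e i) = edge_source (e (Suc i))"
    and "inj e" and "finite (range (\<lambda>i. p2346 (e i)))"
    and edges: "\<And>m. \<exists>r. e ` {..<m} \<subseteq> snd (monitor_graph D C a r)"
  shows "\<exists>r. k_cyclic k (monitor_graph D C a r)"
proof -
  obtain i0 where inf: "infinite {i. p2346 (e i) = p2346 (e i0)}"
    using pigeonhole_infinite[of "UNIV :: nat set" "\<lambda>i. p2346 (e i)"] assms(3) by auto
  define P where "P i \<longleftrightarrow> p2346 (e i) = p2346 (e i0)" for i
  obtain A where A: "A \<subseteq> {i. P i}" "finite A" "card A = k"
    using infinite_arbitrarily_large[OF inf] unfolding P_def by metis
  obtain m where m: "A \<subseteq> {..<m}"
    using A(2) finite_nat_bounded by blast
  obtain r where r: "e ` {..<m} \<subseteq> snd (monitor_graph D C a r)"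
    using edges by blast
  \<comment> \<open>Filtering keeps the chosen indices in increasing order, which makes
    \<open>?vs\<close> a subsequence of the path \<open>?p\<close>.\<close>
  let ?is = "filter (\<lambda>i. i \<in> A) [0..<m]"
  let ?vs = "map e ?is" and ?p = "map e [0..<m]"
  have set_is: "set ?is = A"
    using m by auto
  then have len: "length ?vs = k"
    using A(3) distinct_card[of ?is] by simp
  have "p2346 (?vs ! i) = p2346 (e i0)" if "i < k" for i
  proof -
    have "?is ! i \<in> A"
      using that len set_is nth_mem[of i ?is] by auto
    then show ?thesis
      using A(1) that len by (auto simp: P_def)
  qed
  moreover have "distinct ?vs"
    using \<open>inj e\<close> by (auto simp: distinct_map intro: inj_on_subset)
  moreover have "set ?vs \<subseteq> snd (monitor_graph D C a r)"
    using r m set_is by auto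
  moreover have "is_path (monitor_graph D C a r) ?p"
    using r path by (auto simp: is_path_def)
  moreover have "subseq ?vs ?p"
    by (intro subseq_map subseq_filter_left)
  ultimately show ?thesis
    unfolding k_cyclic_def using len by (metis Suc_lessD)
qed

section \<open>The infinite path through one fresh null per creating step\<close>

theorem lemma3:
  fixes Rs :: "'r set" and ar :: "'r \<Rightarrow> nat"
    and \<Sigma> :: "('r, 'c::infinite, 'v::infinite) constr set"
    and I0 :: "('r, 'c, 'n::infinite) db"
    and D :: "nat \<Rightarrow> ('r, 'c, 'n) db"
    and C :: "nat \<Rightarrow> ('r, 'c, 'v) constr"
    and a :: "nat \<Rightarrow> 'v \<Rightarrow> ('c, 'n) val"
    and k :: nat
  assumes "finite Rs"
    and "finite \<Sigma>" and "\<forall>\<phi>\<in>\<Sigma>. wf_constr Rs ar \<phi>"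
    and "db_instance Rs ar I0"
    and "k \<ge> 1"
    and "infinite_chase \<Sigma> I0 D C a"
  shows "\<exists>r. k_cyclic k (monitor_graph D C a r)"
proof -
  have C: "C i \<in> \<Sigma>" and steps: "chase_step (\<Union>j\<le>i. nulls (D j)) (D i) (C i) (a i) (D (Suc i))" for i
    using assms(6) by (auto simp: infinite_chase_def)
  have wf: "wf_constr Rs ar (C i)" for i
    using C assms(3) by blast
  have inst: "db_instance Rs ar (D i)" for i
  proof (induction i)
    case 0
    then show ?case
      using assms(4,6) by (simp add: infinite_chase_def)
  next
    case (Suc i)
    then show ?case
      using chase_step_instance[OF steps wf] by blast
  qed
  let ?T = "{i. \<not> nulls (D (Suc i)) \<subseteq> nulls (D i)}"
  have "infinite ?T"
    using infinitely_many_creating_steps[OF assms(1-3) inst assms(6)] .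
  \<comment> \<open>The creating steps in increasing order. Step \<open>t i\<close> leads from
    \<open>D (t i)\<close> to \<open>D (Suc (t i))\<close>, so its new nulls first occur in the
    latter.\<close>
  define t where "t = enumerate ?T"
  have t_mono: "t i < t (Suc i)" for i
    unfolding t_def using \<open>infinite ?T\<close> by (rule enumerate_step)
  have "t i \<in> ?T" for i
    unfolding t_def using \<open>infinite ?T\<close> by (rule enumerate_in_set)
  then have "\<forall>i. \<exists>n. n \<in> nulls (D (Suc (t i))) - nulls (D (t i))"
    by blast
  then obtain n where n: "\<And>i. n i \<in> nulls (D (Suc (t i))) - nulls (D (t i))"
    by metis
  have TGD: "is_TGD (C (t i))" and fresh: "n i \<notin> (\<Union>j\<le>t i. nulls (D j))" for i
    using chase_step_new_null[OF steps wf n] by auto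
  define \<pi> where "\<pi> i = null_positions (n i) (D (Suc (t i)))" for i
  \<comment> \<open>The edge that step \<open>t (Suc i)\<close> draws from the previous pick to its
    own. Its source is present by then, since \<open>Suc (t i)\<close> is at most
    \<open>t (Suc i)\<close>.\<close>
  define e where "e i = (n i, \<pi> i, C (t (Suc i)),
    null_positions (n i) (inst_conj (a (t (Suc i))) (body (C (t (Suc i))))),
    n (Suc i), \<pi> (Suc i))" for i
  have node: "(n i, \<pi> i) \<in> fst (monitor_graph D C a (Suc (t i)))" for i
    unfolding \<pi>_def using TGD n by (rule monitor_graph_new_node)
  have edge: "e i \<in> snd (monitor_graph D C a (Suc (t (Suc i))))" for i
  proof -
    have "(n i, \<pi> i) \<in> fst (monitor_graph D C a (t (Suc i)))"
      using node[of i] monitor_graph_mono(1)[of "Suc (t i)" "t (Suc i)" D C a] t_mono[of i] by auto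
    then show ?thesis
      unfolding e_def \<pi>_def[of "Suc i"] using n[of "Suc i"] fresh[of "Suc i"] TGD[of "Suc i"]
      by (intro monitor_graph_new_edge) auto
  qed
  show ?thesis
  proof (rule k_cyclic_if_finitely_many_labels)
    show "edge_target (e i) = edge_source (e (Suc i))" for i
      by (simp add: e_def)
    \<comment> \<open>The earlier pick occurs in \<open>D (Suc (t i))\<close>, an instance among
      those up to \<open>t j\<close>, all of which lack \<open>n j\<close>. Edges inherit
      distinctness from their source nulls.\<close>
    have "n i \<noteq> n j" if "i < j" for i j
    proof -
      have "Suc (t i) \<le> t j"
        using lift_Suc_mono_less[of t, OF t_mono that] by simp
      then show ?thesis
        using n[of i] fresh[of j] by auto
    qed
    then have "inj n"
      by (auto intro!: inj_onI) (metis linorder_neqE_nat)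
    then show "inj e"
      by (auto simp: inj_def e_def)
    show "finite (range (\<lambda>i. p2346 (e i)))"
    proof (rule finite_subset)
      \<comment> \<open>Labels forget the nulls; what remains is a constraint from \<Sigma> and
        three sets of positions of the finite schema.\<close>
      let ?P = "Pow (positions Rs ar)"
      show "range (\<lambda>i. p2346 (e i)) \<subseteq> ?P \<times> \<Sigma> \<times> ?P \<times> ?P"
      proof (rule image_subsetI)
        fix i
        have "\<pi> j \<in> ?P" for j
          unfolding \<pi>_def using inst null_positions_subset by (fastforce simp: db_instance_def)
        moreover have "null_positions m (inst_conj b (body (C j))) \<in> ?P" for m b j
          using null_positions_subset[of "inst_conj b (body (C j))" Rs ar]
            over_schema_inst_conj[OF wf_constr_body[OF wf]] by blast
        ultimately show "p2346 (e i) \<in> ?P \<times> \<Sigma> \<times> ?P \<times> ?P"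
          using C by (simp add: e_def)
      qed
      show "finite (?P \<times> \<Sigma> \<times> ?P \<times> ?P)"
        using assms(1,2) by (simp add: finite_positions)
    qed
    show "\<exists>r. e ` {..<m} \<subseteq> snd (monitor_graph D C a r)" for m
    proof
      \<comment> \<open>The last edge of a nonempty segment is \<open>e (m - 1)\<close>, drawn by
        step \<open>t m\<close>.\<close>
      show "e ` {..<m} \<subseteq> snd (monitor_graph D C a (Suc (t m)))"
      proof (rule image_subsetI)
        fix i assume "i \<in> {..<m}"
        then have "t (Suc i) \<le> t m"
          using lift_Suc_mono_le[of t "Suc i" m] t_mono by (simp add: less_imp_le)
        then show "e i \<in> snd (monitor_graph D C a (Suc (t m)))"
          using edge[of i] monitor_graph_mono(2)[of "Suc (t (Suc i))" "Suc (t m)" D C a] by auto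
      qed
    qed
  qed
qed

end
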